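(* Let $I_t$ denote the matching with $t$ edges (i.e. $t$ pairwise vertex-disjoint edges). Then, as $n\to\infty$: (i) $C(n,I_4)=\Omega(n^{1/5})$; (ii) $C(n,I_t)=\Omega(n^{1/3})$ for $t\in\{5,6\}$; (iii) $C(n,I_t)=\Omega(n^{1/2})$ for every $t\geqslant 7$.
   Context: For a graph $H$ and a positive integer $n$, $C(n,H)$ denotes the minimum integer $k$ such that there exist $n$ colorings $f_v:E(K_n)\to[k]$, one for each vertex $v\in V(K_n)$ (the colorings need not be proper), with the following property: for every copy $T$ of $H$ in $K_n$, there is a vertex $v\in V(T)$ such that $f_v$ assigns pairwise distinct colors to all edges of $E(T)$. *)

theory Defs
  imports "HOL-Library.Ramsey" "HOL-Library.Landau_Symbols"
begin

text \<open>A finite simple graph is a pair of a vertex set and a set of two-element sets of vertices.\<close>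

type_synonym 'a sgraph = "'a set \<times> 'a set set"

abbreviation verts :: "'a sgraph \<Rightarrow> 'a set" where
  "verts G \<equiv> fst G"

abbreviation edges :: "'a sgraph \<Rightarrow> 'a set set" where
  "edges G \<equiv> snd G"

definition simple_graph :: "'a sgraph \<Rightarrow> bool" where
  "simple_graph G \<longleftrightarrow> finite (verts G) \<and> edges G \<subseteq> nsets (verts G) 2"

definition complete_graph :: "nat \<Rightarrow> nat sgraph" where
  "complete_graph n = ({1..n}, nsets {1..n} 2)"

definition subgraph :: "'a sgraph \<Rightarrow> 'a sgraph \<Rightarrow> bool" where
  "subgraph T G \<longleftrightarrow> simple_graph T \<and> verts T \<subseteq> verts G \<and> edges T \<subseteq> edges G"

definition isomorphic :: "'a sgraph \<Rightarrow> 'b sgraph \<Rightarrow> bool" where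
  "isomorphic G H \<longleftrightarrow>
     (\<exists>\<phi>. bij_betw \<phi> (verts G) (verts H) \<and> edges H = (\<lambda>e. \<phi> ` e) ` edges G)"

definition copy_of :: "'a sgraph \<Rightarrow> 'b sgraph \<Rightarrow> 'b sgraph \<Rightarrow> bool" where
  "copy_of H G T \<longleftrightarrow> subgraph T G \<and> isomorphic H T"

definition good_colorings :: "nat \<Rightarrow> 'a sgraph \<Rightarrow> nat \<Rightarrow> (nat \<Rightarrow> nat set \<Rightarrow> nat) \<Rightarrow> bool" where
  "good_colorings n H k f \<longleftrightarrow>
     (\<forall>v\<in>verts (complete_graph n). f v \<in> edges (complete_graph n) \<rightarrow> {1..k}) \<and>
     (\<forall>T. copy_of H (complete_graph n) T \<longrightarrow> (\<exists>v\<in>verts T. inj_on (f v) (edges T)))"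

definition C :: "nat \<Rightarrow> 'a sgraph \<Rightarrow> nat" where
  "C n H = (LEAST k. \<exists>f. good_colorings n H k f)"

definition matching :: "nat \<Rightarrow> nat sgraph" where
  "matching t = ({..<2 * t}, {{2 * i, 2 * i + 1} | i. i < t})"

lemma simple_graph_matching: "simple_graph (matching t)"
  by (auto simp: simple_graph_def matching_def nsets_def)

text \<open>The minimum defining \<open>C n H\<close> exists for every graph with at least one vertex,
  since all edges of the complete graph may receive different colors.\<close>

lemma good_colorings_exist:
  assumes "verts H \<noteq> {}"
  shows "\<exists>k f. good_colorings n H k f"
proof -
  let ?E = "edges (complete_graph n)"
  have "finite ?E"
    by (simp add: complete_graph_def finite_imp_finite_nsets)
  then obtain g where g: "bij_betw g ?E {1..card ?E}"
    using ex_bij_betw_finite_nat ex_bij_betw_nat_finite_1 bij_betw_inv by metis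
  have "good_colorings n H (card ?E) (\<lambda>_. g)"
    unfolding good_colorings_def
  proof (intro conjI ballI allI impI)
    show "g \<in> ?E \<rightarrow> {1..card ?E}"
      using g by (auto simp: bij_betw_def)
  next
    fix T
    assume T: "copy_of H (complete_graph n) T"
    then have "verts T \<noteq> {}"
      using assms by (auto simp: copy_of_def isomorphic_def bij_betw_def)
    moreover have "inj_on g (edges T)"
      using T g by (auto simp: copy_of_def subgraph_def bij_betw_def intro: inj_on_subset)
    ultimately show "\<exists>v\<in>verts T. inj_on g (edges T)"
      by blast
  qed
  then show ?thesis by blast
qed

end

theory Submission
  imports Defs "HOL-Library.Disjoint_Sets"
begin

text \<open>Among \<open>2 k\<close> disjoint edges every coloring with \<open>k\<close> colors has at least \<open>k\<close> monochromatic
  ordered pairs, so by averaging some two edges \<open>e\<^sub>1\<close>, \<open>e\<^sub>2\<close> receive the same color from a set \<open>S\<close> of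
  about \<open>n / (4 k)\<close> vertices. Any matching formed by \<open>e\<^sub>1\<close>, \<open>e\<^sub>2\<close> and edges inside \<open>S\<close> can only be
  rainbow for one of the four endpoints of \<open>e\<^sub>1\<close> and \<open>e\<^sub>2\<close>. Split these four vertices into \<open>g\<close>
  groups of size \<open>q\<close>; each group induces a coloring with \<open>k ^ q\<close> colors. If \<open>S\<close> contains more than
  \<open>g k ^ q\<close> disjoint edges, one of them shares its color with another edge in each of the \<open>g\<close>
  colorings, and so \<open>g + 1\<close> edges inside \<open>S\<close> spoil all four endpoints. Hence
  \<open>n = O(k ^ (q + 1))\<close> as soon as \<open>t \<ge> g + 3\<close>; the three bounds are the cases
  \<open>(g, q) = (1, 4), (2, 2), (4, 1)\<close>.\<close>

section \<open>Repeated colors and monochromatic pairs\<close>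

lemma card_singleton_color_classes:
  assumes "finite X" "c ` E \<subseteq> X"
  shows "card {e \<in> E. \<forall>e'\<in>E. c e' = c e \<longrightarrow> e' = e} \<le> card X"
proof (rule card_inj_on_le)
  show "inj_on c {e \<in> E. \<forall>e'\<in>E. c e' = c e \<longrightarrow> e' = e}"
    by (auto intro!: inj_onI)
qed (use assms in auto)

text \<open>Double counting: at most \<open>k\<close> of the \<open>2 * k\<close> edges have a color
  of their own under \<open>f v\<close>, so each \<open>v\<close> sees at least \<open>k\<close>
  ordered monochromatic pairs. There are at most \<open>4 * k\<^sup>2\<close> ordered pairs, hence
  some pair is monochromatic for a fraction \<open>1 / (4 * k)\<close> of \<open>V\<close>.\<close>

lemma exists_popular_monochromatic_pair:
  assumes "finite V" "V \<noteq> {}" "card E = 2 * k" "0 < k"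
    and col: "\<And>v. v \<in> V \<Longrightarrow> f v ` E \<subseteq> {1..k}"
  shows "\<exists>e\<in>E. \<exists>e'\<in>E. e \<noteq> e' \<and> card V \<le> 4 * k * card {v \<in> V. f v e = f v e'}"
proof (rule ccontr)
  assume neg: "\<not> ?thesis"
  have fE: "finite E"
    using assms by (metis card.infinite mult_eq_0_iff not_gr_zero zero_neq_numeral)
  define P where "P = {p \<in> E \<times> E. fst p \<noteq> snd p}"
  define mono where "mono v p \<longleftrightarrow> f v (fst p) = f v (snd p)" for v p
  have fP: "finite P"
    using fE by (simp add: P_def)
  have cP: "card P \<le> 4 * k\<^sup>2"
  proof -
    have "card P \<le> card (E \<times> E)"
      using fE by (intro card_mono) (auto simp: P_def)
    then show ?thesis
      using assms by (simp add: card_cartesian_product power2_eq_square)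
  qed
  have pairs: "k \<le> card {p \<in> P. mono v p}" if v: "v \<in> V" for v
  proof -
    let ?A = "{e \<in> E. \<forall>e'\<in>E. f v e' = f v e \<longrightarrow> e' = e}"
    have "card ?A \<le> k"
      using card_singleton_color_classes[of "{1..k}" "f v" E] col[OF v] by simp
    moreover have "card (E - ?A) = card E - card ?A"
      using fE by (intro card_Diff_subset) auto
    ultimately have "k \<le> card (E - ?A)"
      using assms by linarith
    \<comment> \<open>Counting ordered pairs lets every edge with a repeated color appear as a first
      component.\<close>
    also have "\<dots> \<le> card (fst ` {p \<in> P. mono v p})"
    proof (rule card_mono)
      show "finite (fst ` {p \<in> P. mono v p})"
        using fP by simp
      show "E - ?A \<subseteq> fst ` {p \<in> P. mono v p}"
      proof
        fix e assume "e \<in> E - ?A"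
        then obtain e' where "e \<in> E" "e' \<in> E" "f v e' = f v e" "e' \<noteq> e"
          by blast
        then have "(e, e') \<in> {p \<in> P. mono v p}"
          by (auto simp: P_def mono_def)
        then show "e \<in> fst ` {p \<in> P. mono v p}"
          by force
      qed
    qed
    also have "\<dots> \<le> card {p \<in> P. mono v p}"
      using fP by (intro card_image_le) auto
    finally show ?thesis .
  qed
  have swap: "(\<Sum>v\<in>V. card {p \<in> P. mono v p}) = (\<Sum>p\<in>P. card {v \<in> V. mono v p})"
    using sum.swap_restrict[OF \<open>finite V\<close> fP, of "\<lambda>_ _. 1 :: nat" mono] by simp
  have less: "4 * k * card {v \<in> V. mono v p} < card V" if "p \<in> P" for p
    using neg that by (force simp: P_def mono_def not_le)
  \<comment> \<open>Strictness of the summed inequality needs at least one summand.\<close>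
  have "P \<noteq> {}"
    using pairs assms by fastforce
  then have "(\<Sum>p\<in>P. 4 * k * card {v \<in> V. mono v p}) < (\<Sum>p\<in>P. card V)"
    using less fP by (intro sum_strict_mono) auto
  also have "\<dots> \<le> 4 * k\<^sup>2 * card V"
    using cP by simp
  finally have "4 * k * (\<Sum>v\<in>V. card {p \<in> P. mono v p}) < 4 * k\<^sup>2 * card V"
    by (simp add: swap sum_distrib_left)
  moreover have "card V * k \<le> (\<Sum>v\<in>V. card {p \<in> P. mono v p})"
    using sum_mono[of V "\<lambda>_. k"] pairs by simp
  then have "4 * k * (card V * k) \<le> 4 * k * (\<Sum>v\<in>V. card {p \<in> P. mono v p})"
    by (rule mult_le_mono2)
  ultimately show False
    by (simp add: power2_eq_square algebra_simps)
qed

section \<open>Disjoint pairs as copies of the matching\<close>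

lemma exists_disjoint_pairs:
  assumes "finite S" "2 * m \<le> card S"
  shows "\<exists>M. card M = m \<and> M \<subseteq> nsets S 2 \<and> disjoint M"
  using assms
proof (induction m arbitrary: S)
  case 0
  show ?case
    by (rule exI[of _ "{}"]) auto
next
  case (Suc m)
  then obtain e where e: "e \<subseteq> S" "card e = 2" "finite e"
    by (metis obtain_subset_with_card_n mult_Suc_right le_add1 le_trans)
  have "2 * m \<le> card (S - e)"
    using Suc.prems e by (simp add: card_Diff_subset)
  then obtain M where M: "card M = m" "M \<subseteq> nsets (S - e) 2" "disjoint M"
    using Suc.IH[of "S - e"] Suc.prems by auto
  have "finite M"
    using M(2) Suc.prems by (meson finite_Diff finite_imp_finite_nsets finite_subset)
  moreover have M_away: "x \<inter> e = {}" "x \<subseteq> S" "card x = 2" "finite x" if "x \<in> M" for x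
    using M(2) that by (auto simp: nsets_def)
  then have "e \<notin> M"
    using e by fastforce
  ultimately have "card (insert e M) = Suc m"
    using M(1) by simp
  moreover have "insert e M \<subseteq> nsets S 2"
    using M_away e by (auto simp: nsets_def)
  moreover have "disjoint (insert e M)"
    using M(3) M_away(1) by (auto simp: pairwise_insert disjnt_def)
  ultimately show ?case
    by blast
qed

text \<open>Enumerate \<open>F\<close> and send \<open>2 * i\<close> and \<open>2 * i + 1\<close> to
  the two ends of the \<open>i\<close>-th edge; taking \<open>\<Union>F\<close> as vertex set leaves
  no vertex uncovered.\<close>

lemma disjoint_pairs_copy_of_matching:
  assumes F: "F \<subseteq> nsets {1..n} 2" "disjoint F" "card F = t" "finite F"
  shows "copy_of (matching t) (complete_graph n) (\<Union>F, F)"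
proof -
  obtain g where g: "bij_betw g {..<t} F"
    using F(3,4) ex_bij_betw_nat_finite[of F] by (auto simp: atLeast0LessThan)
  have "\<exists>x y. e = {x, y} \<and> x \<noteq> y" if "e \<in> F" for e
    using that F(1) by (auto simp: nsets_def card_2_iff)
  then obtain p q where pq: "\<And>e. e \<in> F \<Longrightarrow> e = {p e, q e} \<and> p e \<noteq> q e"
    by metis
  define \<phi> where "\<phi> j = (if even j then p (g (j div 2)) else q (g (j div 2)))" for j :: nat
  have gF: "g i \<in> F" if "i < t" for i
    using g that by (auto simp: bij_betw_def)
  have \<phi>_mem: "\<phi> j \<in> g (j div 2)" if "j < 2 * t" for j
  proof -
    have "j div 2 < t"
      using that by simp
    from pq[OF gF[OF this]] show ?thesis
      unfolding \<phi>_def by (metis insertCI)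
  qed
  have pair: "\<phi> ` {2 * i, 2 * i + 1} = g i" if "i < t" for i
    using pq[OF gF[OF that]] by (auto simp: \<phi>_def)
  have inj: "inj_on \<phi> {..<2 * t}"
  proof (rule inj_onI)
    fix i j assume ij: "i \<in> {..<2 * t}" "j \<in> {..<2 * t}" "\<phi> i = \<phi> j"
    have lt: "i div 2 < t" "j div 2 < t"
      using ij by auto
    have "\<not> disjnt (g (i div 2)) (g (j div 2))"
      using \<phi>_mem[of i] \<phi>_mem[of j] ij by (auto simp: disjnt_def)
    then have "g (i div 2) = g (j div 2)"
      using F(2) gF[OF lt(1)] gF[OF lt(2)] by (meson pairwiseD)
    then have "i div 2 = j div 2"
      using g lt by (auto simp: bij_betw_def inj_on_def)
    \<comment> \<open>Within one edge the two ends differ, so the image determines the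
      parity.\<close>
    moreover have "even i \<longleftrightarrow> even j"
      using ij(3) \<open>g (i div 2) = g (j div 2)\<close> pq[OF gF[OF lt(2)]]
      by (auto simp: \<phi>_def split: if_splits)
    ultimately show "i = j"
      by presburger
  qed
  have edges: "F = (\<lambda>e. \<phi> ` e) ` {{2 * i, 2 * i + 1} | i. i < t}"
  proof -
    have "(\<lambda>e. \<phi> ` e) ` {{2 * i, 2 * i + 1} | i. i < t}
        = (\<lambda>i. \<phi> ` {2 * i, 2 * i + 1}) ` {..<t}"
      by blast
    also have "\<dots> = g ` {..<t}"
      using pair by (intro image_cong) auto
    finally show ?thesis
      using g by (simp add: bij_betw_def)
  qed
  have "\<phi> ` {..<2 * t} = \<Union>F"
  proof
    show "\<phi> ` {..<2 * t} \<subseteq> \<Union>F"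
    proof (rule image_subsetI)
      fix j assume "j \<in> {..<2 * t}"
      then have "\<phi> j \<in> g (j div 2)" "g (j div 2) \<in> F"
        using \<phi>_mem gF by auto
      then show "\<phi> j \<in> \<Union>F"
        by blast
    qed
    show "\<Union>F \<subseteq> \<phi> ` {..<2 * t}"
    proof
      fix x assume "x \<in> \<Union>F"
      then obtain i where i: "i < t" "x \<in> g i"
        using g by (auto simp: bij_betw_def)
      then have "x \<in> \<phi> ` {2 * i, 2 * i + 1}"
        using pair by blast
      then show "x \<in> \<phi> ` {..<2 * t}"
        using i(1) by auto
    qed
  qed
  then have "isomorphic (matching t) (\<Union>F, F)"
    using inj edges unfolding isomorphic_def matching_def bij_betw_def fst_conv snd_conv by blast
  moreover have "subgraph (\<Union>F, F) (complete_graph n)"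
    using F(1,4) by (auto simp: subgraph_def simple_graph_def complete_graph_def nsets_def)
  ultimately show ?thesis
    by (simp add: copy_of_def)
qed

section \<open>The bound for fixed \<open>n\<close>\<close>

text \<open>Each coloring isolates at most \<open>card X\<close> elements, so by the union bound
  some \<open>e\<close> is isolated by none of them. Then \<open>e\<close> with one partner per
  coloring suffices; partners may coincide.\<close>

lemma exists_small_set_not_injective:
  assumes "finite E" "finite X" "finite I" "card I * card X < card E"
    and "\<And>i. i \<in> I \<Longrightarrow> c i ` E \<subseteq> X"
  shows "\<exists>F\<subseteq>E. card F \<le> card I + 1 \<and> (\<forall>i\<in>I. \<not> inj_on (c i) F)"
proof -
  define A where "A i = {e \<in> E. \<forall>e'\<in>E. c i e' = c i e \<longrightarrow> e' = e}" for i
  have "card (\<Union>i\<in>I. A i) \<le> (\<Sum>i\<in>I. card (A i))"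
    using assms by (intro card_UN_le)
  also have "\<dots> \<le> (\<Sum>i\<in>I. card X)"
    unfolding A_def using assms by (intro sum_mono card_singleton_color_classes) auto
  also have "\<dots> < card E"
    using assms by simp
  finally have "\<not> E \<subseteq> (\<Union>i\<in>I. A i)"
    using card_mono[of "\<Union>i\<in>I. A i" E] assms by (force simp: A_def)
  then obtain e where e: "e \<in> E" "\<And>i. i \<in> I \<Longrightarrow> e \<notin> A i"
    by blast
  then have "\<forall>i\<in>I. \<exists>e'\<in>E. c i e' = c i e \<and> e' \<noteq> e"
    by (auto simp: A_def)
  then obtain h where h: "\<And>i. i \<in> I \<Longrightarrow> h i \<in> E \<and> c i (h i) = c i e \<and> h i \<noteq> e"
    by metis
  show ?thesis
  proof (intro exI conjI ballI)
    show "insert e (h ` I) \<subseteq> E"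
      using e h by auto
    have "card (insert e (h ` I)) \<le> Suc (card (h ` I))"
      by (rule card_insert_le_m1) simp_all
    then show "card (insert e (h ` I)) \<le> card I + 1"
      using card_image_le[OF \<open>finite I\<close>, of h] by linarith
    show "\<not> inj_on (c i) (insert e (h ` I))" if "i \<in> I" for i
      using h[OF that] that by (auto simp: inj_on_def)
  qed
qed

text \<open>The lists in \<open>cover\<close> are the groups of endpoints; \<open>a b c d\<close>
  are arbitrary, so lists may repeat or coincide. In the constant, \<open>4 * k\<close> comes from
  averaging, a factor 2 from the two vertices per edge, and the summand 2 from deleting four
  endpoints.\<close>

lemma good_colorings_matching_bound:
  assumes good: "good_colorings n (matching t) k f" and n: "2 \<le> n" and t: "g + 3 \<le> t"
    and cover: "\<And>a b c d :: nat. \<exists>\<L>. finite \<L> \<and> card \<L> \<le> g \<and> (\<forall>L\<in>\<L>. length L = q) \<and>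
                 (\<Union>L\<in>\<L>. set L) = {a, b, c, d}"
  shows "n \<le> 8 * (g + t + 2) * k ^ (q + 1)"
proof (rule ccontr)
  assume "\<not> ?thesis"
  then have big: "8 * (g + t + 2) * k ^ (q + 1) < n"
    by simp
  have col: "f v e \<in> {1..k}" if "v \<in> {1..n}" "e \<in> nsets {1..n} 2" for v e
    using good that unfolding good_colorings_def complete_graph_def fst_conv snd_conv by blast
  have "{1, 2} \<in> nsets {1..n} 2"
    using n by (auto simp: nsets_def)
  then have k: "0 < k"
    using col[of 1 "{1, 2}"] n by auto
  have kq: "1 \<le> k ^ q"
    using k by simp
  have "4 * k * 1 \<le> 8 * (g + t + 2) * k * k ^ q"
    using kq by (intro mult_le_mono) auto
  then have "2 * (2 * k) \<le> card {1..n}"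
    using big by (simp add: algebra_simps)
  then obtain M where M: "card M = 2 * k" "M \<subseteq> nsets {1..n} 2" "disjoint M"
    using exists_disjoint_pairs[of "{1..n}" "2 * k"] by auto
  have "\<exists>e\<in>M. \<exists>e'\<in>M. e \<noteq> e' \<and> card {1..n} \<le> 4 * k * card {v \<in> {1..n}. f v e = f v e'}"
    using n M k col by (intro exists_popular_monochromatic_pair) auto
  then obtain e1 e2 where e: "e1 \<in> M" "e2 \<in> M" "e1 \<noteq> e2"
    and pop: "n \<le> 4 * k * card {v \<in> {1..n}. f v e1 = f v e2}"
    by auto
  have e_nsets: "e1 \<in> nsets {1..n} 2" "e2 \<in> nsets {1..n} 2"
    using e M by auto
  then obtain a b c d where abcd: "e1 = {a, b}" "e2 = {c, d}"
    by (auto simp: nsets_def card_2_iff)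
  have disj12: "e1 \<inter> e2 = {}"
    using e M by (auto simp: pairwise_def disjnt_def)
  \<comment> \<open>Deleting the endpoints keeps every edge inside \<open>S\<close> disjoint from
    \<open>e1\<close> and \<open>e2\<close>.\<close>
  define S where "S = {v \<in> {1..n}. f v e1 = f v e2} - {a, b, c, d}"
  have fS: "finite S"
    by (simp add: S_def)
  have "card {v \<in> {1..n}. f v e1 = f v e2} - card {a, b, c, d} \<le> card S"
    unfolding S_def by (intro diff_card_le_card_Diff) auto
  moreover have "card {a, b, c, d} \<le> 4"
    by (auto simp: card_insert_if)
  ultimately have "card {v \<in> {1..n}. f v e1 = f v e2} \<le> card S + 4"
    by linarith
  then have nS: "n \<le> 4 * k * (card S + 4)"
    using pop by (meson le_trans mult_le_mono2)
  \<comment> \<open>Room for \<open>g * k ^ q + t\<close> disjoint edges: the extra \<open>t\<close>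
    makes the pigeonhole count strict and leaves edges for padding.\<close>
  have large: "2 * (g * k ^ q + t) \<le> card S"
  proof (rule ccontr)
    assume "\<not> ?thesis"
    then have "card S + 4 \<le> 2 * (g * k ^ q + t + 2)"
      by simp
    also have "\<dots> \<le> 2 * (g * k ^ q + t * k ^ q + 2 * k ^ q)"
      using kq by (intro mult_le_mono2 add_mono) auto
    also have "\<dots> = 2 * (g + t + 2) * k ^ q"
      by (simp add: algebra_simps)
    finally have "4 * k * (card S + 4) \<le> 4 * k * (2 * (g + t + 2) * k ^ q)"
      by (rule mult_le_mono2)
    then show False
      using nS big by (simp add: algebra_simps)
  qed
  obtain N where N: "card N = g * k ^ q + t" "N \<subseteq> nsets S 2" "disjoint N"
    using exists_disjoint_pairs[OF fS large] by blast
  have fN: "finite N"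
    using N(2) fS by (meson finite_imp_finite_nsets finite_subset)
  have N_n: "N \<subseteq> nsets {1..n} 2"
  proof -
    have "S \<subseteq> {1..n}"
      by (auto simp: S_def)
    then show ?thesis
      using N(2) nsets_mono by blast
  qed
  obtain \<L> where \<L>: "finite \<L>" "card \<L> \<le> g" "\<And>L. L \<in> \<L> \<Longrightarrow> length L = q"
    "(\<Union>L\<in>\<L>. set L) = {a, b, c, d}"
    using cover[of a b c d] by blast
  \<comment> \<open>A group acts as one coloring by tuples: equal tuples mean equal colors at every
    vertex of the group.\<close>
  let ?c = "\<lambda>L e. map (\<lambda>v. f v e) L"
  let ?X = "{xs. set xs \<subseteq> {1..k} \<and> length xs = q}"
  have abcd_n: "{a, b, c, d} \<subseteq> {1..n}"
    using e_nsets by (auto simp: nsets_def abcd)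
  have "\<exists>F\<subseteq>N. card F \<le> card \<L> + 1 \<and> (\<forall>L\<in>\<L>. \<not> inj_on (?c L) F)"
  proof (rule exists_small_set_not_injective[OF fN, of ?X])
    have "card ?X = k ^ q"
      using card_lists_length_eq[of "{1..k}" q] by simp
    then have "card \<L> * card ?X \<le> g * k ^ q"
      using \<L>(2) by simp
    then show "card \<L> * card ?X < card N"
      using N(1) t by linarith
    show "?c L ` N \<subseteq> ?X" if L: "L \<in> \<L>" for L
    proof -
      have "set L \<subseteq> {1..n}"
        using L \<L>(4) abcd_n by blast
      then show ?thesis
        using \<L>(3)[OF L] col N_n by fastforce
    qed
  qed (use \<L>(1) in \<open>auto intro: finite_lists_length_eq\<close>)
  then obtain F where F: "F \<subseteq> N" "card F \<le> card \<L> + 1"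
    and noninj: "\<And>L. L \<in> \<L> \<Longrightarrow> \<not> inj_on (?c L) F"
    by blast
  \<comment> \<open>Since \<open>g + 1 \<le> t - 2\<close>, the spoiling set can be padded so that
    with \<open>e1\<close> and \<open>e2\<close> there are exactly \<open>t\<close> edges.\<close>
  have "card F \<le> t - 2" "t - 2 \<le> card N"
    using F(2) \<L>(2) t N(1) by linarith+
  then obtain F' where F': "F \<subseteq> F'" "F' \<subseteq> N" "card F' = t - 2"
    using exists_subset_between[OF _ _ F(1) fN] by blast
  define T where "T = insert e1 (insert e2 F')"
  have fF': "finite F'"
    using F'(2) fN finite_subset by blast
  have away: "x \<inter> e1 = {}" "x \<inter> e2 = {}" "x \<noteq> {}" if "x \<in> F'" for x
    using that F'(2) N(2) by (auto simp: nsets_def S_def abcd)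
  have "copy_of (matching t) (complete_graph n) (\<Union>T, T)"
  proof (rule disjoint_pairs_copy_of_matching)
    show "T \<subseteq> nsets {1..n} 2"
      using e_nsets F'(2) N_n by (auto simp: T_def)
    have "disjoint F'"
      using N(3) F'(2) by (rule pairwise_subset)
    then show "disjoint T"
      using away(1,2) disj12 unfolding T_def pairwise_insert disjnt_def by blast
    have "e1 \<notin> F'" "e2 \<notin> F'"
      using away[of e1] away[of e2] by blast+
    then show "card T = t"
      using e(3) F'(3) fF' t by (simp add: T_def)
    show "finite T"
      using fF' by (simp add: T_def)
  qed
  then obtain v where v: "v \<in> \<Union>T" and inj: "inj_on (f v) T"
    using good unfolding good_colorings_def by (metis fst_conv snd_conv)
  show False
  \<comment> \<open>An endpoint is spoiled by two edges of \<open>F\<close>; any other vertex lies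
    in \<open>S\<close> and is spoiled by \<open>e1\<close> and \<open>e2\<close>.\<close>
  proof (cases "v \<in> {a, b, c, d}")
    case True
    then obtain L where L: "L \<in> \<L>" "v \<in> set L"
      using \<L>(4) by blast
    obtain x y where "x \<in> F" "y \<in> F" "?c L x = ?c L y" "x \<noteq> y"
      using noninj[OF L(1)] by (auto simp: inj_on_def)
    then have "f v x = f v y" "x \<in> T" "y \<in> T" "x \<noteq> y"
      using L(2) F'(1) by (auto simp: T_def)
    then show False
      using inj by (auto dest: inj_onD)
  next
    case False
    then obtain x where "x \<in> F'" "v \<in> x"
      using v by (auto simp: T_def abcd)
    then have "v \<in> S"
      using F'(2) N(2) by (auto simp: nsets_def)
    then have "f v e1 = f v e2"
      by (simp add: S_def)
    then show False
      using inj e(3) by (auto simp: T_def dest: inj_onD)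
  qed
qed

section \<open>Asymptotic form and the three cases\<close>

lemma C_matching_bigomega:
  assumes t: "g + 3 \<le> t"
    and cover: "\<And>a b c d :: nat. \<exists>\<L>. finite \<L> \<and> card \<L> \<le> g \<and> (\<forall>L\<in>\<L>. length L = q) \<and>
                 (\<Union>L\<in>\<L>. set L) = {a, b, c, d}"
  shows "(\<lambda>n. real (C n (matching t))) \<in> \<Omega>(\<lambda>n. real n powr (1 / real (q + 1)))"
proof -
  define A where "A = real (8 * (g + t + 2))"
  define r where "r = 1 / real (q + 1)"
  have "real n powr r \<le> A powr r * real (C n (matching t))" if n: "2 \<le> n" for n
  proof -
    let ?k = "C n (matching t)"
    \<comment> \<open>This ensures that the minimum defining \<open>C\<close> is attained.\<close>
    have "verts (matching t) \<noteq> {}"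
      using t by (auto simp: matching_def lessThan_empty_iff)
    then have "\<exists>f. good_colorings n (matching t) ?k f"
      unfolding C_def by (rule LeastI_ex[OF good_colorings_exist])
    then obtain f where "good_colorings n (matching t) ?k f" ..
    from good_colorings_matching_bound[OF this n t cover]
    have "real n \<le> real (8 * (g + t + 2) * ?k ^ (q + 1))"
      by (simp only: of_nat_le_iff)
    then have le: "real n \<le> A * real ?k ^ (q + 1)"
      by (simp add: A_def)
    \<comment> \<open>A zero value would force \<open>n = 0\<close>; positivity is what allows
      passing from natural powers to \<open>powr\<close>.\<close>
    then have k: "0 < real ?k"
      using n by (cases "?k = 0") auto
    have "real n powr r \<le> (A * real ?k ^ (q + 1)) powr r"
      using le by (intro powr_mono2) (auto simp: r_def)
    also have "\<dots> = A powr r * (real ?k powr real (q + 1)) powr r"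
      using k by (simp only: powr_realpow powr_mult)
    also have "\<dots> = A powr r * real ?k"
      using k by (simp only: powr_powr) (simp add: r_def)
    finally show ?thesis .
  qed
  then have "(\<lambda>n. real n powr r) \<in> O(\<lambda>n. real (C n (matching t)))"
    by (intro bigoI[of _ "A powr r"] eventually_sequentiallyI[of 2]) auto
  then show ?thesis
    by (simp add: bigomega_iff_bigo r_def)
qed

theorem theorem6:
  shows "((\<lambda>n. real (C n (matching 4))) \<in> \<Omega>(\<lambda>n. real n powr (1 / 5))) \<and>
    (\<forall>t\<in>{5, 6}. (\<lambda>n. real (C n (matching t))) \<in> \<Omega>(\<lambda>n. real n powr (1 / 3))) \<and>
    (\<forall>t\<ge>7. (\<lambda>n. real (C n (matching t))) \<in> \<Omega>(\<lambda>n. real n powr (1 / 2)))"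
proof -
  have four: "(\<lambda>n. real (C n (matching t))) \<in> \<Omega>(\<lambda>n. real n powr (1 / real (4 + 1)))"
    if "4 \<le> t" for t
  proof (rule C_matching_bigomega[where g = 1])
    show "\<exists>\<L>. finite \<L> \<and> card \<L> \<le> 1 \<and> (\<forall>L\<in>\<L>. length L = 4) \<and> (\<Union>L\<in>\<L>. set L) = {a, b, c, d}"
      for a b c d :: nat
      by (rule exI[of _ "{[a, b, c, d]}"]) auto
  qed (use that in simp)
  have two: "(\<lambda>n. real (C n (matching t))) \<in> \<Omega>(\<lambda>n. real n powr (1 / real (2 + 1)))"
    if "5 \<le> t" for t
  proof (rule C_matching_bigomega[where g = 2])
    show "\<exists>\<L>. finite \<L> \<and> card \<L> \<le> 2 \<and> (\<forall>L\<in>\<L>. length L = 2) \<and> (\<Union>L\<in>\<L>. set L) = {a, b, c, d}"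
      for a b c d :: nat
      \<comment> \<open>The two lists are equal if \<open>a = c\<close> and \<open>b = d\<close>, so
        only an upper bound on the cardinality holds.\<close>
      by (rule exI[of _ "{[a, b], [c, d]}"]) (auto simp: card_insert_if)
  qed (use that in simp)
  have one: "(\<lambda>n. real (C n (matching t))) \<in> \<Omega>(\<lambda>n. real n powr (1 / real (1 + 1)))"
    if "7 \<le> t" for t
  proof (rule C_matching_bigomega[where g = 4])
    show "\<exists>\<L>. finite \<L> \<and> card \<L> \<le> 4 \<and> (\<forall>L\<in>\<L>. length L = 1) \<and> (\<Union>L\<in>\<L>. set L) = {a, b, c, d}"
      for a b c d :: nat
      by (rule exI[of _ "{[a], [b], [c], [d]}"]) (auto simp: card_insert_if)
  qed (use that in simp)
  show ?thesis
    using four[of 4] two one by auto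
qed

end
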